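(* Let $n_1,n_2,n_3\ge 2$ be integers with $n_1$ odd, and let $N=\tfrac12 (n_1-1)(n_2-1)(n_3-1)$. Let $$T_1=\sum_{i_1=0}^{n_1}\sum_{i_2=0}^{n_2}\sum_{i_3=0}^{n_3} v^1_{i_1}\otimes v^2_{i_2}\otimes v^3_{i_3}\otimes v^4_{i_1,i_2,i_3}\in V_1\otimes V_2\otimes V_3\otimes V_4,$$ where $V_p=\mathbb{C}^{n_p+1}$ has basis $\{v^p_{i}: 0\le i\le n_p\}$ for $p=1,2,3$, and $V_4=\mathbb{C}^{(n_1+1)(n_2+1)(n_3+1)}$ has basis $\{v^4_{i_1,i_2,i_3}: 0\le i_p\le n_p\}$. Let $$T_2=\sum_{j=1}^{N} w^1_j\otimes w^2_j\otimes w^3\otimes w^4\in W_1\otimes W_2\otimes W_3\otimes W_4,$$ where $W_p=\mathbb{C}^N$ has basis $\{w^p_j: 1\le j\le N\}$ for $p=1,2$, and $W_p=\mathbb{C}^1$ is spanned by $w^p$ for $p=3,4$. Then $$\underline{\mathrm{R}}(T_1)=(n_1+1)(n_2+1)(n_3+1),\qquad \underline{\mathrm{R}}(T_2)=N,$$ and $$\underline{\mathrm{R}}(T_1\oplus T_2)=(n_1+1)(n_2+1)(n_3+1)+1.$$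
   Context: All vector spaces are finite dimensional over $\mathbb{C}$. For a tensor $T\in V_1\otimes\cdots\otimes V_k$, the tensor rank $\mathrm{R}(T)$ is the least $r$ such that $T=\sum_{i=1}^r v_1^{(i)}\otimes\cdots\otimes v_k^{(i)}$ with $v_j^{(i)}\in V_j$. The border rank $\underline{\mathrm{R}}(T)$ is the least $r$ such that $T=\lim_{\varepsilon\to0}T_\varepsilon$ (Euclidean topology) for tensors $T_\varepsilon\in V_1\otimes\cdots\otimes V_k$ with $\mathrm{R}(T_\varepsilon)=r$ for $\varepsilon\ne0$. For $T\in V_1\otimes\cdots\otimes V_k$ and $S\in W_1\otimes\cdots\otimes W_k$, the direct sum $T\oplus S$ is the tensor $T+S\in (V_1\oplus W_1)\otimes\cdots\otimes(V_k\oplus W_k)$, where $V_j,W_j$ are regarded as the two summands of $V_j\oplus W_j$. *)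

theory Defs
  imports "HOL-Analysis.Analysis" "HOL-Library.Function_Algebras"
begin

text \<open>
  A finite-dimensional complex space with a chosen basis indexed by a finite set I is represented
  by its coordinates: functions I to the complex numbers, extended by 0 outside I. Accordingly the
  tensor product of the spaces with index sets A, B, C, D consists of the complex functions
  supported on A \<times> B \<times> C \<times> D. Addition and finite sums of vectors and tensors
  are the pointwise ones of \<^theory>\<open>HOL-Library.Function_Algebras\<close>.
\<close>

type_synonym ('a, 'b, 'c, 'd) tensor = "'a \<times> 'b \<times> 'c \<times> 'd \<Rightarrow> complex"

definition coord_space :: "'a set \<Rightarrow> ('a \<Rightarrow> complex) set" where
  "coord_space I = {v. \<forall>i. i \<notin> I \<longrightarrow> v i = 0}"

definition basis_vec :: "'a \<Rightarrow> 'a \<Rightarrow> complex" where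
  "basis_vec i = (\<lambda>j. if j = i then 1 else 0)"

definition tprod :: "('a \<Rightarrow> complex) \<Rightarrow> ('b \<Rightarrow> complex) \<Rightarrow> ('c \<Rightarrow> complex) \<Rightarrow> ('d \<Rightarrow> complex)
    \<Rightarrow> ('a, 'b, 'c, 'd) tensor" where
  "tprod u v w z = (\<lambda>(a, b, c, d). u a * v b * w c * z d)"

definition tensor_rank :: "'a set \<Rightarrow> 'b set \<Rightarrow> 'c set \<Rightarrow> 'd set \<Rightarrow> ('a, 'b, 'c, 'd) tensor \<Rightarrow> nat" where
  "tensor_rank A B C D T = (LEAST r. \<exists>u v w z.
     (\<forall>i<r. u i \<in> coord_space A \<and> v i \<in> coord_space B \<and> w i \<in> coord_space C \<and> z i \<in> coord_space D) \<and>
     T = (\<Sum>i<r. tprod (u i) (v i) (w i) (z i)))"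

text \<open>
  Convergence below is in the product topology on functions, that is, coordinatewise; on tensors
  supported on a fixed finite index set this is convergence in the Euclidean topology.
\<close>

definition border_rank :: "'a set \<Rightarrow> 'b set \<Rightarrow> 'c set \<Rightarrow> 'd set \<Rightarrow> ('a, 'b, 'c, 'd) tensor \<Rightarrow> nat" where
  "border_rank A B C D T = (LEAST r. \<exists>F :: real \<Rightarrow> ('a, 'b, 'c, 'd) tensor.
     (\<forall>\<epsilon>. \<epsilon> \<noteq> 0 \<longrightarrow> F \<epsilon> \<in> coord_space (A \<times> B \<times> C \<times> D) \<and> tensor_rank A B C D (F \<epsilon>) = r) \<and>
     (F \<longlongrightarrow> T) (at 0))"

text \<open>
  If V and W have index sets A and A', then their direct sum has index set A <+> A', with Inl and
  Inr labelling the basis vectors of the two summands. The maps below are the inclusions of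
  tensor products induced by the inclusions of the left, respectively right, summands.
\<close>

definition tensor_inl :: "('a, 'b, 'c, 'd) tensor \<Rightarrow> ('a + 'e, 'b + 'f, 'c + 'g, 'd + 'h) tensor" where
  "tensor_inl T = (\<lambda>x. case x of (Inl a, Inl b, Inl c, Inl d) \<Rightarrow> T (a, b, c, d) | _ \<Rightarrow> 0)"

definition tensor_inr :: "('e, 'f, 'g, 'h) tensor \<Rightarrow> ('a + 'e, 'b + 'f, 'c + 'g, 'd + 'h) tensor" where
  "tensor_inr S = (\<lambda>x. case x of (Inr a, Inr b, Inr c, Inr d) \<Rightarrow> S (a, b, c, d) | _ \<Rightarrow> 0)"

definition tensor_dsum :: "('a, 'b, 'c, 'd) tensor \<Rightarrow> ('e, 'f, 'g, 'h) tensor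
    \<Rightarrow> ('a + 'e, 'b + 'f, 'c + 'g, 'd + 'h) tensor" (infixl "\<oplus>\<^sub>T" 65) where
  "T \<oplus>\<^sub>T S = tensor_inl T + tensor_inr S"

end

theory Submission
  imports Defs
begin

text \<open>
  The lower bounds come from flattenings. Each of the three tensors has a flattening, along its last
  factor or along its first, that contains an identity matrix of the claimed size. A tensor close
  to it has a flattening containing a matrix close to the identity, hence an invertible one, and a
  sum of fewer simple tensors cannot produce that (\<open>near_identity_minor_rank\<close>). The first two
  tensors are written as sums of exactly as many simple tensors, so only the upper bound for the
  direct sum needs an idea.

  That idea is Schoenhage's. Write a, b, c for the basis vectors of the first three spaces and d
  for those of the fourth, let w span the added line in the fourth space, and consider
    \<open>(1/\<epsilon>\<^sup>3) (\<Sum>\<^bsub>x,y,z\<^esub> (a\<^sub>x + \<epsilon> u\<^bsub>xyz\<^esub>) \<otimes> (b\<^sub>y + \<epsilon> v\<^bsub>xyz\<^esub>) \<otimes> (c\<^sub>z + \<epsilon> s\<^bsub>xyz\<^esub>) \<otimes> (w + \<epsilon>\<^sup>3 d\<^bsub>xyz\<^esub>)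
              - (\<Sum>a) \<otimes> (\<Sum>b) \<otimes> (\<Sum>c) \<otimes> w)\<close>,
  with u, v, s in the second summands. It uses just one simple tensor more than there are grid
  points. The subtracted term removes the part of order 0. If the parts of order 1 and 2 in \<open>\<epsilon>\<close>
  vanish as well, which is the condition \<open>cancelling_perturbation\<close>, then the limit is
    \<open>\<Sum> a\<^sub>x \<otimes> b\<^sub>y \<otimes> c\<^sub>z \<otimes> d\<^bsub>xyz\<^esub> + \<Sum> u\<^bsub>xyz\<^esub> \<otimes> v\<^bsub>xyz\<^esub> \<otimes> s\<^bsub>xyz\<^esub> \<otimes> w\<close>
  (\<open>schonhage_degeneration\<close>).

  It remains to choose u, v, s so that the second sum is \<open>(\<Sum>\<^sub>j w\<^sub>j \<otimes> w\<^sub>j) \<otimes> w' \<otimes> w\<close>, where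
  \<open>w'\<close> spans the line added to the third space (\<open>schonhage_vectors_exist\<close>). Since the first side of the grid has
  even length, its points can be paired and the two partners given opposite signs. Let u be the
  same at both partners, and let v and s change sign. Then uv and us cancel within each pair,
  whereas uvs does not change sign and survives. The sums of vs vanish because v sums to zero over
  y and s does not depend on y.
\<close>

section \<open>Functions as vectors\<close>

lemma sum_fun_apply: "(\<Sum>k\<in>K. f k) t = (\<Sum>k\<in>K. f k t)"
  for f :: "'k \<Rightarrow> 'a \<Rightarrow> 'b::comm_monoid_add"
  by (induction K rule: infinite_finite_induct) simp_all

lemma tendsto_fun_iff: "(F \<longlongrightarrow> T) G \<longleftrightarrow> (\<forall>t. ((\<lambda>x. F x t) \<longlongrightarrow> T t) G)"
  for F :: "'x \<Rightarrow> 'a \<Rightarrow> 'b::topological_space"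
proof -
  have "(F \<longlongrightarrow> T) G \<longleftrightarrow> limitin (product_topology (\<lambda>_. euclidean) UNIV) F T G"
    by (simp add: euclidean_product_topology)
  then show ?thesis
    unfolding limitin_componentwise by simp
qed

section \<open>Sums of simple tensors\<close>

text \<open>
  Such a sum may have superfluous terms, so the property only says that the tensor rank is at
  most r. In this form it is preserved by addition without any minimality argument.
\<close>

definition simple_sum ::
    "'a set \<Rightarrow> 'b set \<Rightarrow> 'c set \<Rightarrow> 'd set \<Rightarrow> nat \<Rightarrow> ('a, 'b, 'c, 'd) tensor \<Rightarrow> bool" where
  "simple_sum A B C D r T \<longleftrightarrow> (\<exists>u v w z.
     (\<forall>i<r. u i \<in> coord_space A \<and> v i \<in> coord_space B \<and> w i \<in> coord_space C \<and> z i \<in> coord_space D) \<and>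
     T = (\<Sum>i<r. tprod (u i) (v i) (w i) (z i)))"

lemma tensor_rank_eq_Least: "tensor_rank A B C D T = (LEAST r. simple_sum A B C D r T)"
  by (simp add: tensor_rank_def simple_sum_def)

lemma simple_sum_zero: "simple_sum A B C D 0 0"
  by (simp add: simple_sum_def)

lemma simple_sum_tprod:
  assumes "u \<in> coord_space A" "v \<in> coord_space B" "w \<in> coord_space C" "z \<in> coord_space D"
  shows "simple_sum A B C D 1 (tprod u v w z)"
  unfolding simple_sum_def
  by (rule exI[of _ "\<lambda>_. u"], rule exI[of _ "\<lambda>_. v"], rule exI[of _ "\<lambda>_. w"],
      rule exI[of _ "\<lambda>_. z"]) (use assms in simp)

lemma simple_sum_add:
  assumes "simple_sum A B C D r T" "simple_sum A B C D s S"
  shows "simple_sum A B C D (r + s) (T + S)"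
proof -
  obtain u v w z where 1: "\<forall>i<r. u i \<in> coord_space A \<and> v i \<in> coord_space B \<and> w i \<in> coord_space C \<and> z i \<in> coord_space D"
    and T: "T = (\<Sum>i<r. tprod (u i) (v i) (w i) (z i))"
    using assms(1) unfolding simple_sum_def by blast
  obtain u' v' w' z' where 2: "\<forall>i<s. u' i \<in> coord_space A \<and> v' i \<in> coord_space B \<and> w' i \<in> coord_space C \<and> z' i \<in> coord_space D"
    and S: "S = (\<Sum>i<s. tprod (u' i) (v' i) (w' i) (z' i))"
    using assms(2) unfolding simple_sum_def by blast
  define U where "U i = (if i < r then u i else u' (i - r))" for i
  define V where "V i = (if i < r then v i else v' (i - r))" for i
  define W where "W i = (if i < r then w i else w' (i - r))" for i
  define Z where "Z i = (if i < r then z i else z' (i - r))" for i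
  have split: "(\<Sum>i<r + s. f i) = (\<Sum>i<r. f i) + (\<Sum>i<s. f (r + i))" for f :: "nat \<Rightarrow> ('a, 'b, 'c, 'd) tensor"
    by (induction s) (simp_all add: add.assoc)
  have "T + S = (\<Sum>i<r + s. tprod (U i) (V i) (W i) (Z i))"
    unfolding split by (simp add: T S U_def V_def W_def Z_def)
  moreover have "\<forall>i<r + s. U i \<in> coord_space A \<and> V i \<in> coord_space B \<and> W i \<in> coord_space C \<and> Z i \<in> coord_space D"
    using 1 2 by (auto simp: U_def V_def W_def Z_def)
  ultimately show ?thesis
    unfolding simple_sum_def by blast
qed

lemma simple_sum_sum:
  assumes "finite K" "\<And>k. k \<in> K \<Longrightarrow> simple_sum A B C D m (f k)"
  shows "simple_sum A B C D (card K * m) (\<Sum>k\<in>K. f k)"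
  using assms
  by (induction K rule: finite_induct) (auto intro: simple_sum_zero simple_sum_add)

lemma simple_sum_coord_space:
  assumes "simple_sum A B C D r T"
  shows "T \<in> coord_space (A \<times> B \<times> C \<times> D)"
  using assms
  by (auto simp: simple_sum_def coord_space_def sum_fun_apply tprod_def intro!: sum.neutral)

text \<open>
  The tensor rank is a least element of a set of naturals, which says something only once the set
  is nonempty. Expanding a tensor in the basis of the tensor product shows that it is.
\<close>

lemma simple_sum_exists:
  assumes "finite A" "finite B" "finite C" "finite D" "T \<in> coord_space (A \<times> B \<times> C \<times> D)"
  shows "\<exists>r. simple_sum A B C D r T"
proof -
  have fin: "finite (A \<times> B \<times> C \<times> D)"
    using assms by simp
  define f where "f = (\<lambda>(a, b, c, d).
    tprod (basis_vec a) (basis_vec b) (basis_vec c) (\<lambda>d'. T (a, b, c, d) * basis_vec d d'))"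
  have "f k \<in> Collect (simple_sum A B C D 1)" if "k \<in> A \<times> B \<times> C \<times> D" for k
    using that by (auto simp: f_def coord_space_def basis_vec_def intro!: simple_sum_tprod[unfolded One_nat_def])
  then have "simple_sum A B C D (card (A \<times> B \<times> C \<times> D) * 1) (\<Sum>k\<in>A \<times> B \<times> C \<times> D. f k)"
    by (intro simple_sum_sum fin) auto
  moreover have "T = (\<Sum>k\<in>A \<times> B \<times> C \<times> D. f k)"
  proof
    fix t
    have "(\<Sum>k\<in>A \<times> B \<times> C \<times> D. f k) t = (\<Sum>k\<in>A \<times> B \<times> C \<times> D. if k = t then T t else 0)"
      unfolding sum_fun_apply
      by (intro sum.cong refl) (auto simp: f_def tprod_def basis_vec_def split: prod.splits)
    also have "\<dots> = T t"
      using fin assms(5) unfolding coord_space_def mem_Collect_eq sum.delta[OF fin]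
      by (metis (full_types))
    finally show "T t = (\<Sum>k\<in>A \<times> B \<times> C \<times> D. f k) t" ..
  qed
  ultimately show ?thesis by metis
qed

section \<open>Flattenings near the identity\<close>

text \<open>
  Gaussian elimination: an equation with a nonzero coefficient is used to eliminate one unknown
  from the others.
\<close>

lemma homogeneous_system_nontrivial_solution:
  fixes q :: "nat \<Rightarrow> 'i \<Rightarrow> 'f::field"
  assumes "finite I" "r < card I"
  shows "\<exists>x. (\<exists>i\<in>I. x i \<noteq> 0) \<and> (\<forall>l<r. (\<Sum>i\<in>I. q l i * x i) = 0)"
  using assms
proof (induction r arbitrary: I q)
  case 0
  then have "I \<noteq> {}" by auto
  then show ?case by (intro exI[of _ "\<lambda>_. 1"]) auto
next
  case (Suc r)
  show ?case
  proof (cases "\<exists>k\<in>I. q r k \<noteq> 0")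
    case False
    obtain x where "\<exists>i\<in>I. x i \<noteq> 0" "\<forall>l<r. (\<Sum>i\<in>I. q l i * x i) = 0"
      using Suc.IH[of I q] Suc.prems by auto
    then show ?thesis
      using False by (intro exI[of _ x]) (auto simp: less_Suc_eq)
  next
    case True
    then obtain k where k: "k \<in> I" "q r k \<noteq> 0" by blast
    define q' where "q' l i = q l i - q l k * q r i / q r k" for l i
    have "finite (I - {k})" "r < card (I - {k})"
      using Suc.prems k by auto
    from Suc.IH[OF this, of q'] obtain x where x: "\<exists>i\<in>I - {k}. x i \<noteq> 0"
      "\<forall>l<r. (\<Sum>i\<in>I - {k}. q' l i * x i) = 0" by blast
    define s where "s = (\<Sum>i\<in>I - {k}. q r i * x i)"
    define y where "y = x(k := - s / q r k)"
    have eval: "(\<Sum>i\<in>I. q l i * y i) = (\<Sum>i\<in>I - {k}. q l i * x i) - q l k * s / q r k" for l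
    proof -
      have "(\<Sum>i\<in>I. q l i * y i) = q l k * y k + (\<Sum>i\<in>I - {k}. q l i * y i)"
        using Suc.prems(1) k(1) by (rule sum.remove)
      also have "(\<Sum>i\<in>I - {k}. q l i * y i) = (\<Sum>i\<in>I - {k}. q l i * x i)"
        by (intro sum.cong) (auto simp: y_def)
      finally show ?thesis by (simp add: y_def)
    qed
    have "(\<Sum>i\<in>I - {k}. q' l i * x i) = (\<Sum>i\<in>I. q l i * y i)" for l
      unfolding eval s_def
      by (simp add: q'_def left_diff_distrib sum_subtractf sum_distrib_left sum_divide_distrib mult.assoc)
    then have "(\<Sum>i\<in>I. q l i * y i) = 0" if "l < r" for l
      using x(2) that by simp
    moreover have "(\<Sum>i\<in>I. q r i * y i) = 0"
      unfolding eval using k(2) by (simp add: s_def)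
    moreover have "\<exists>i\<in>I. y i \<noteq> 0"
      using x(1) by (auto simp: y_def)
    ultimately show ?thesis
      by (intro exI[of _ y]) (auto simp: less_Suc_eq)
  qed
qed

text \<open>
  The matrix is strictly diagonally dominant. Compare both sides of the equation that belongs to a
  coordinate of x of maximal norm.
\<close>

lemma near_identity_kernel:
  fixes G :: "'i \<Rightarrow> 'i \<Rightarrow> complex"
  assumes I: "finite I"
    and near: "\<And>i j. i \<in> I \<Longrightarrow> j \<in> I \<Longrightarrow> norm (G i j - (if i = j then 1 else 0)) < 1 / (card I + 1)"
    and ker: "\<And>i. i \<in> I \<Longrightarrow> (\<Sum>j\<in>I. G i j * x j) = 0"
    and i: "i \<in> I"
  shows "x i = 0"
proof -
  define M where "M = Max ((\<lambda>j. norm (x j)) ` I)"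
  have M: "norm (x j) \<le> M" if "j \<in> I" for j
    using I that by (auto simp: M_def)
  have "M \<in> (\<lambda>j. norm (x j)) ` I"
    unfolding M_def using I i by (intro Max_in) auto
  then obtain k where k: "k \<in> I" "norm (x k) = M" by auto
  have "x k = (\<Sum>j\<in>I. (if k = j then 1 else 0) * x j) - (\<Sum>j\<in>I. G k j * x j)"
    using I k(1) ker[OF k(1)] by (simp add: if_distrib[of "\<lambda>t. t * _"] cong: if_cong)
  also have "\<dots> = - (\<Sum>j\<in>I. (G k j - (if k = j then 1 else 0)) * x j)"
    by (simp add: left_diff_distrib sum_subtractf)
  finally have "M = norm (\<Sum>j\<in>I. (G k j - (if k = j then 1 else 0)) * x j)"
    using k(2) by simp
  also have "\<dots> \<le> (\<Sum>j\<in>I. norm ((G k j - (if k = j then 1 else 0)) * x j))"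
    by (rule norm_sum)
  also have "\<dots> \<le> (\<Sum>j\<in>I. 1 / (card I + 1) * M)"
    unfolding norm_mult using near[OF k(1), THEN less_imp_le] M by (intro sum_mono mult_mono) auto
  finally have "M \<le> card I / (card I + 1) * M" by simp
  then have "M * (card I + 1) \<le> M * card I"
    by (simp add: field_simps)
  then have "M \<le> 0" by (simp add: algebra_simps)
  then show ?thesis using M[OF i] by (metis norm_le_zero_iff order_trans)
qed

text \<open>
  Arrangements of tensor positions in a square matrix such that every simple tensor gives a matrix
  of rank at most one. Submatrices of all flattenings arise in this way, so one lower bound serves
  flattenings along different factors.
\<close>

definition flattening_minor :: "'i set \<Rightarrow> ('i \<Rightarrow> 'i \<Rightarrow> 'a \<times> 'b \<times> 'c \<times> 'd) \<Rightarrow> bool" where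
  "flattening_minor I pos \<longleftrightarrow> (\<forall>u v w z. \<exists>p q. \<forall>i\<in>I. \<forall>j\<in>I.
     tprod u v w z (pos i j) = p i * q j)"

text \<open>
  A sum of r simple tensors fills the minor with a matrix that factors through an r-dimensional
  space. With r below the size of the minor this matrix has a kernel, which a matrix near the
  identity does not have.
\<close>

lemma near_identity_minor_rank:
  fixes T :: "('a, 'b, 'c, 'd) tensor"
  assumes I: "finite I" and pos: "flattening_minor I pos"
    and near: "\<And>i j. i \<in> I \<Longrightarrow> j \<in> I \<Longrightarrow> norm (T (pos i j) - (if i = j then 1 else 0)) < 1 / (card I + 1)"
    and T: "simple_sum A B C D r T"
  shows "card I \<le> r"
proof (rule ccontr)
  assume "\<not> card I \<le> r"
  then have r: "r < card I" by simp
  obtain u v w z where T: "T = (\<Sum>l<r. tprod (u l) (v l) (w l) (z l))"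
    using T unfolding simple_sum_def by blast
  have "\<forall>l. \<exists>p q. \<forall>i\<in>I. \<forall>j\<in>I. tprod (u l) (v l) (w l) (z l) (pos i j) = p i * q j"
    using pos unfolding flattening_minor_def by blast
  then obtain p q where pq: "\<And>l i j. i \<in> I \<Longrightarrow> j \<in> I \<Longrightarrow> tprod (u l) (v l) (w l) (z l) (pos i j) = p l i * q l j"
    by metis
  obtain x where x: "\<exists>i\<in>I. x i \<noteq> 0" "\<forall>l<r. (\<Sum>j\<in>I. q l j * x j) = 0"
    using homogeneous_system_nontrivial_solution[OF I r, of q] by blast
  have "(\<Sum>j\<in>I. T (pos i j) * x j) = 0" if i: "i \<in> I" for i
  proof -
    have "(\<Sum>j\<in>I. T (pos i j) * x j) = (\<Sum>j\<in>I. \<Sum>l<r. p l i * (q l j * x j))"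
      using i by (intro sum.cong) (simp_all add: T sum_fun_apply pq sum_distrib_right mult.assoc)
    also have "\<dots> = (\<Sum>l<r. p l i * (\<Sum>j\<in>I. q l j * x j))"
      by (subst sum.swap) (simp add: sum_distrib_left)
    also have "\<dots> = 0" using x(2) by simp
    finally show ?thesis .
  qed
  then have "\<forall>i\<in>I. x i = 0"
    using near_identity_kernel[of I "\<lambda>i j. T (pos i j)", OF I near] by blast
  with x(1) show False by blast
qed

text \<open>
  An identity minor of the limit bounds the rank from below for every approximating family close to
  0, because the bound of \<open>near_identity_minor_rank\<close> holds on a neighbourhood. A family F with that
  many simple terms therefore has exactly this rank, but only for small \<open>\<epsilon>\<close>, whereas border rank
  asks for it at every nonzero \<open>\<epsilon>\<close>. The family is therefore made constant away from 0.
\<close>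

lemma border_rank_eqI:
  fixes T :: "('a, 'b, 'c, 'd) tensor"
  assumes fin: "finite A" "finite B" "finite C" "finite D" "finite I"
    and pos: "flattening_minor I pos"
    and minor: "\<And>i j. i \<in> I \<Longrightarrow> j \<in> I \<Longrightarrow> T (pos i j) = (if i = j then 1 else 0)"
    and F: "(F \<longlongrightarrow> T) (at (0::real))" "\<And>\<epsilon>. \<epsilon> \<noteq> 0 \<Longrightarrow> simple_sum A B C D (card I) (F \<epsilon>)"
  shows "border_rank A B C D T = card I"
proof -
  have lower: "\<forall>\<^sub>F \<epsilon> in at 0. \<forall>r. simple_sum A B C D r (G \<epsilon>) \<longrightarrow> card I \<le> r"
    if G: "(G \<longlongrightarrow> T) (at (0::real))" for G
  proof -
    have "\<forall>\<^sub>F \<epsilon> in at 0. norm (G \<epsilon> (pos i j) - T (pos i j)) < 1 / (card I + 1)" for i j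
      unfolding dist_norm[symmetric]
      by (rule tendstoD[OF G[unfolded tendsto_fun_iff, rule_format]]) simp
    then have "\<forall>\<^sub>F \<epsilon> in at 0. \<forall>i\<in>I. \<forall>j\<in>I. norm (G \<epsilon> (pos i j) - T (pos i j)) < 1 / (card I + 1)"
      using fin(5) by (intro eventually_ball_finite ballI)
    then show ?thesis
    proof eventually_elim
      case (elim \<epsilon>)
      then show ?case
        using near_identity_minor_rank[OF fin(5) pos, of "G \<epsilon>"] minor by auto
    qed
  qed
  obtain \<delta> where \<delta>: "\<delta> > 0" "\<And>\<epsilon> r. \<epsilon> \<noteq> 0 \<Longrightarrow> \<bar>\<epsilon>\<bar> < \<delta> \<Longrightarrow> simple_sum A B C D r (F \<epsilon>) \<Longrightarrow> card I \<le> r"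
    using lower[OF F(1)] unfolding eventually_at by (auto simp: dist_real_def)
  define F' where "F' \<epsilon> = F (if \<bar>\<epsilon>\<bar> < \<delta> then \<epsilon> else \<delta> / 2)" for \<epsilon>
  have "\<forall>\<^sub>F \<epsilon> in at 0. F \<epsilon> = F' \<epsilon>"
    using \<delta>(1) unfolding eventually_at by (intro exI[of _ \<delta>]) (auto simp: F'_def dist_real_def)
  then have lim: "(F' \<longlongrightarrow> T) (at 0)"
    using F(1) tendsto_cong by blast
  have rank: "F' \<epsilon> \<in> coord_space (A \<times> B \<times> C \<times> D) \<and> tensor_rank A B C D (F' \<epsilon>) = card I" if "\<epsilon> \<noteq> 0" for \<epsilon>
  proof -
    define \<eta> where "\<eta> = (if \<bar>\<epsilon>\<bar> < \<delta> then \<epsilon> else \<delta> / 2)"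
    have \<eta>: "\<eta> \<noteq> 0" "\<bar>\<eta>\<bar> < \<delta>" using \<delta>(1) that by (auto simp: \<eta>_def)
    have "tensor_rank A B C D (F \<eta>) = card I"
      unfolding tensor_rank_eq_Least using F(2)[OF \<eta>(1)] \<delta>(2)[OF \<eta>] by (intro Least_equality) auto
    then show ?thesis
      using simple_sum_coord_space[OF F(2)[OF \<eta>(1)]] by (simp add: F'_def \<eta>_def)
  qed
  show ?thesis
    unfolding border_rank_def
  proof (rule Least_equality)
    show "\<exists>F. (\<forall>\<epsilon>::real. \<epsilon> \<noteq> 0 \<longrightarrow> F \<epsilon> \<in> coord_space (A \<times> B \<times> C \<times> D) \<and> tensor_rank A B C D (F \<epsilon>) = card I) \<and>
      (F \<longlongrightarrow> T) (at 0)"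
      by (rule exI[of _ F']) (simp add: rank lim)
  next
    fix r
    assume "\<exists>G. (\<forall>\<epsilon>. \<epsilon> \<noteq> 0 \<longrightarrow> G \<epsilon> \<in> coord_space (A \<times> B \<times> C \<times> D) \<and> tensor_rank A B C D (G \<epsilon>) = r) \<and>
      (G \<longlongrightarrow> T) (at (0::real))"
    then obtain G where G: "\<And>\<epsilon>. \<epsilon> \<noteq> 0 \<Longrightarrow> G \<epsilon> \<in> coord_space (A \<times> B \<times> C \<times> D) \<and> tensor_rank A B C D (G \<epsilon>) = r"
      and Glim: "(G \<longlongrightarrow> T) (at (0::real))" by blast
    have "\<forall>\<^sub>F \<epsilon> in at (0::real). \<epsilon> \<noteq> 0"
      by (simp add: eventually_at_filter)
    with lower[OF Glim] have "\<forall>\<^sub>F \<epsilon> in at (0::real). \<epsilon> \<noteq> 0 \<and> (\<forall>r. simple_sum A B C D r (G \<epsilon>) \<longrightarrow> card I \<le> r)"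
      by eventually_elim simp
    then obtain \<epsilon> where \<epsilon>: "\<epsilon> \<noteq> 0" "\<forall>r. simple_sum A B C D r (G \<epsilon>) \<longrightarrow> card I \<le> r"
      using eventually_happens' at_neq_bot by blast
    have "simple_sum A B C D r (G \<epsilon>)"
      using G[OF \<epsilon>(1)] simple_sum_exists[of A B C D "G \<epsilon>"] fin
      unfolding tensor_rank_eq_Least by (metis LeastI)
    with \<epsilon>(2) show "card I \<le> r" by blast
  qed
qed

section \<open>The degeneration\<close>

text \<open>
  The first three conditions make the terms of order 1 vanish in the expansion of
  \<open>\<Sum> (a\<^sub>x + \<epsilon> u\<^bsub>xyz\<^esub>) \<otimes> (b\<^sub>y + \<epsilon> v\<^bsub>xyz\<^esub>) \<otimes> (c\<^sub>z + \<epsilon> s\<^bsub>xyz\<^esub>)\<close>, and the last three those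
  of order 2. Each term is collected by the basis vectors a, b, c that remain in it.
\<close>

definition cancelling_perturbation ::
    "'a set \<Rightarrow> 'b set \<Rightarrow> 'c set \<Rightarrow> ('a \<Rightarrow> 'b \<Rightarrow> 'c \<Rightarrow> 'j \<Rightarrow> complex) \<Rightarrow>
     ('a \<Rightarrow> 'b \<Rightarrow> 'c \<Rightarrow> 'k \<Rightarrow> complex) \<Rightarrow> ('a \<Rightarrow> 'b \<Rightarrow> 'c \<Rightarrow> 'l \<Rightarrow> complex) \<Rightarrow> bool" where
  "cancelling_perturbation X Y Z u v s \<longleftrightarrow>
    (\<forall>y z j. (\<Sum>x\<in>X. u x y z j) = 0) \<and>
    (\<forall>x z k. (\<Sum>y\<in>Y. v x y z k) = 0) \<and>
    (\<forall>x y l. (\<Sum>z\<in>Z. s x y z l) = 0) \<and>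
    (\<forall>z j k. (\<Sum>x\<in>X. \<Sum>y\<in>Y. u x y z j * v x y z k) = 0) \<and>
    (\<forall>y j l. (\<Sum>x\<in>X. \<Sum>z\<in>Z. u x y z j * s x y z l) = 0) \<and>
    (\<forall>x k l. (\<Sum>y\<in>Y. \<Sum>z\<in>Z. v x y z k * s x y z l) = 0)"

text \<open>
  At a position whose fourth index lies in the left summand, the approximation is a polynomial
  in \<open>\<epsilon>\<close> whose constant term is the entry of the grid tensor. At the other positions it equals its
  limit for all nonzero \<open>\<epsilon>\<close>: each of the three remaining indices selects a basis vector or a
  perturbation, and of the eight combinations one is cancelled by the subtracted term, six vanish
  by the assumed relations, and the last carries \<open>\<epsilon>\<^sup>3\<close>.
\<close>

lemma schonhage_degeneration:
  fixes X :: "'a set" and Y :: "'b set" and Z :: "'c set"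
    and u :: "'a \<Rightarrow> 'b \<Rightarrow> 'c \<Rightarrow> 'j \<Rightarrow> complex" and v :: "'a \<Rightarrow> 'b \<Rightarrow> 'c \<Rightarrow> 'k \<Rightarrow> complex"
    and s :: "'a \<Rightarrow> 'b \<Rightarrow> 'c \<Rightarrow> 'l \<Rightarrow> complex"
  assumes fin: "finite X" "finite Y" "finite Z"
    and supp: "\<And>x y z. u x y z \<in> coord_space J" "\<And>x y z. v x y z \<in> coord_space K"
      "\<And>x y z. s x y z \<in> coord_space L"
    and pert: "cancelling_perturbation X Y Z u v s"
  shows "\<exists>F. (\<forall>\<epsilon>::real. \<epsilon> \<noteq> 0 \<longrightarrow> simple_sum (X <+> J) (Y <+> K) (Z <+> L) ((X \<times> Y \<times> Z) <+> {()})
             (card (X \<times> Y \<times> Z) + 1) (F \<epsilon>)) \<and>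
      (F \<longlongrightarrow> (\<Sum>x\<in>X. \<Sum>y\<in>Y. \<Sum>z\<in>Z. tprod (basis_vec x) (basis_vec y) (basis_vec z) (basis_vec (x, y, z)))
         \<oplus>\<^sub>T (\<Sum>x\<in>X. \<Sum>y\<in>Y. \<Sum>z\<in>Z. tprod (u x y z) (v x y z) (s x y z) (basis_vec ()))) (at 0)"
proof -
  have u: "\<And>y z j. (\<Sum>x\<in>X. u x y z j) = 0"
    and v: "\<And>x z k. (\<Sum>y\<in>Y. v x y z k) = 0"
    and s: "\<And>x y l. (\<Sum>z\<in>Z. s x y z l) = 0"
    and uv: "\<And>z j k. (\<Sum>x\<in>X. \<Sum>y\<in>Y. u x y z j * v x y z k) = 0"
    and us: "\<And>y j l. (\<Sum>x\<in>X. \<Sum>z\<in>Z. u x y z j * s x y z l) = 0"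
    and vs: "\<And>x k l. (\<Sum>y\<in>Y. \<Sum>z\<in>Z. v x y z k * s x y z l) = 0"
    using pert unfolding cancelling_perturbation_def by blast+
  \<comment> \<open>The division by \<open>\<epsilon>\<^sup>3\<close> is absorbed into the fourth vector, so that each summand is visibly simple.\<close>
  define P where "P \<epsilon> x y z = case_sum (basis_vec x) (\<lambda>j. of_real \<epsilon> * u x y z j)" for \<epsilon> :: real and x y z
  define Q where "Q \<epsilon> x y z = case_sum (basis_vec y) (\<lambda>k. of_real \<epsilon> * v x y z k)" for \<epsilon> :: real and x y z
  define R where "R \<epsilon> x y z = case_sum (basis_vec z) (\<lambda>l. of_real \<epsilon> * s x y z l)" for \<epsilon> :: real and x y z
  define W where "W \<epsilon> x y z = case_sum (basis_vec (x, y, z)) (\<lambda>_::unit. inverse (of_real \<epsilon> ^ 3))"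
    for \<epsilon> :: real and x :: 'a and y :: 'b and z :: 'c
  define F where "F \<epsilon> = (\<Sum>x\<in>X. \<Sum>y\<in>Y. \<Sum>z\<in>Z. tprod (P \<epsilon> x y z) (Q \<epsilon> x y z) (R \<epsilon> x y z) (W \<epsilon> x y z))
      + tprod (case_sum (\<lambda>i. if i \<in> X then 1 else 0) (\<lambda>_. 0)) (case_sum (\<lambda>i. if i \<in> Y then 1 else 0) (\<lambda>_. 0))
         (case_sum (\<lambda>i. if i \<in> Z then 1 else 0) (\<lambda>_. 0)) (case_sum (\<lambda>_. 0) (\<lambda>_. - inverse (of_real \<epsilon> ^ 3)))" for \<epsilon>
  let ?T = "\<Sum>x\<in>X. \<Sum>y\<in>Y. \<Sum>z\<in>Z. tprod (basis_vec x) (basis_vec y) (basis_vec z) (basis_vec (x, y, z))"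
  let ?S = "\<Sum>x\<in>X. \<Sum>y\<in>Y. \<Sum>z\<in>Z. tprod (u x y z) (v x y z) (s x y z) (basis_vec ())"
  have delta: "(\<Sum>x\<in>M. basis_vec x a * (g::complex)) = (if a \<in> M then g else 0)" if "finite M" for M a g
    using that by (simp add: basis_vec_def if_distrib[of "\<lambda>t. t * _"] cong: if_cong)
  have rank: "simple_sum (X <+> J) (Y <+> K) (Z <+> L) ((X \<times> Y \<times> Z) <+> {()})
             (card (X \<times> Y \<times> Z) + 1) (F \<epsilon>)" for \<epsilon>
  proof -
    have "simple_sum (X <+> J) (Y <+> K) (Z <+> L) ((X \<times> Y \<times> Z) <+> {()})
       (card X * (card Y * (card Z * 1)) + 1) (F \<epsilon>)"
      unfolding F_def
      by (intro simple_sum_add simple_sum_sum simple_sum_tprod fin)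
         (use supp in \<open>auto simp: coord_space_def P_def Q_def R_def W_def basis_vec_def split: sum.splits\<close>)
    then show ?thesis by (simp add: card_cartesian_product)
  qed
  have cancel: "F \<epsilon> (a, b, c, Inr d) = (?T \<oplus>\<^sub>T ?S) (a, b, c, Inr d)" if \<epsilon>: "\<epsilon> \<noteq> 0" for \<epsilon> a b c d
  proof -
    define e where "e = complex_of_real \<epsilon>"
    have e: "e \<noteq> 0" using \<epsilon> by (simp add: e_def)
    have F_eq: "F \<epsilon> (a, b, c, Inr d) = (\<Sum>x\<in>X. \<Sum>y\<in>Y. \<Sum>z\<in>Z. P \<epsilon> x y z a * Q \<epsilon> x y z b * R \<epsilon> x y z c * inverse (e ^ 3))
       - case_sum (\<lambda>i. if i \<in> X then 1 else 0) (\<lambda>_. 0) a * case_sum (\<lambda>i. if i \<in> Y then 1 else 0) (\<lambda>_. 0) b *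
         case_sum (\<lambda>i. if i \<in> Z then 1 else 0) (\<lambda>_. 0) c * inverse (e ^ 3)"
      by (simp add: F_def sum_fun_apply tprod_def W_def e_def)
    show ?thesis
    proof (cases a; cases b; cases c)
      fix a' b' c' assume [simp]: "a = Inl a'" "b = Inl b'" "c = Inl c'"
      have "(\<Sum>x\<in>X. \<Sum>y\<in>Y. \<Sum>z\<in>Z. P \<epsilon> x y z a * Q \<epsilon> x y z b * R \<epsilon> x y z c * inverse (e ^ 3))
        = (\<Sum>x\<in>X. basis_vec x a' * (\<Sum>y\<in>Y. basis_vec y b' * (\<Sum>z\<in>Z. basis_vec z c' * inverse (e ^ 3))))"
        by (simp add: P_def Q_def R_def sum_distrib_left mult.assoc)
      then show ?thesis
        unfolding F_eq by (simp add: delta fin tensor_dsum_def tensor_inl_def tensor_inr_def)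
    next
      fix a' b' c' assume [simp]: "a = Inr a'" "b = Inl b'" "c = Inl c'"
      have "(\<Sum>x\<in>X. \<Sum>y\<in>Y. \<Sum>z\<in>Z. P \<epsilon> x y z a * Q \<epsilon> x y z b * R \<epsilon> x y z c * inverse (e ^ 3))
        = (\<Sum>y\<in>Y. \<Sum>z\<in>Z. basis_vec y b' * basis_vec z c' * e * inverse (e ^ 3) * (\<Sum>x\<in>X. u x y z a'))"
        unfolding sum_distrib_left
        by (subst sum.swap, intro sum.cong refl, subst sum.swap)
           (simp add: P_def Q_def R_def e_def mult_ac)
      then show ?thesis
        unfolding F_eq by (simp add: u tensor_dsum_def tensor_inl_def tensor_inr_def)
    next
      fix a' b' c' assume [simp]: "a = Inl a'" "b = Inr b'" "c = Inl c'"
      have "(\<Sum>x\<in>X. \<Sum>y\<in>Y. \<Sum>z\<in>Z. P \<epsilon> x y z a * Q \<epsilon> x y z b * R \<epsilon> x y z c * inverse (e ^ 3))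
        = (\<Sum>x\<in>X. \<Sum>z\<in>Z. basis_vec x a' * basis_vec z c' * e * inverse (e ^ 3) * (\<Sum>y\<in>Y. v x y z b'))"
        unfolding sum_distrib_left
        by (intro sum.cong refl, subst sum.swap)
           (simp add: P_def Q_def R_def e_def mult_ac)
      then show ?thesis
        unfolding F_eq by (simp add: v tensor_dsum_def tensor_inl_def tensor_inr_def)
    next
      fix a' b' c' assume [simp]: "a = Inl a'" "b = Inl b'" "c = Inr c'"
      have "(\<Sum>x\<in>X. \<Sum>y\<in>Y. \<Sum>z\<in>Z. P \<epsilon> x y z a * Q \<epsilon> x y z b * R \<epsilon> x y z c * inverse (e ^ 3))
        = (\<Sum>x\<in>X. \<Sum>y\<in>Y. basis_vec x a' * basis_vec y b' * e * inverse (e ^ 3) * (\<Sum>z\<in>Z. s x y z c'))"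
        unfolding sum_distrib_left
        by (simp add: P_def Q_def R_def e_def mult_ac)
      then show ?thesis
        unfolding F_eq by (simp add: s tensor_dsum_def tensor_inl_def tensor_inr_def)
    next
      fix a' b' c' assume [simp]: "a = Inr a'" "b = Inr b'" "c = Inl c'"
      have "(\<Sum>x\<in>X. \<Sum>y\<in>Y. \<Sum>z\<in>Z. P \<epsilon> x y z a * Q \<epsilon> x y z b * R \<epsilon> x y z c * inverse (e ^ 3))
        = (\<Sum>x\<in>X. \<Sum>z\<in>Z. \<Sum>y\<in>Y. basis_vec z c' * e\<^sup>2 * inverse (e ^ 3) * (u x y z a' * v x y z b'))"
        by (intro sum.cong refl, subst sum.swap)
           (simp add: P_def Q_def R_def e_def power2_eq_square mult_ac)
      also have "\<dots> = (\<Sum>z\<in>Z. basis_vec z c' * e\<^sup>2 * inverse (e ^ 3) * (\<Sum>x\<in>X. \<Sum>y\<in>Y. u x y z a' * v x y z b'))"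
        unfolding sum_distrib_left by (rule sum.swap)
      finally show ?thesis
        unfolding F_eq by (simp add: uv tensor_dsum_def tensor_inl_def tensor_inr_def)
    next
      fix a' b' c' assume [simp]: "a = Inr a'" "b = Inl b'" "c = Inr c'"
      have "(\<Sum>x\<in>X. \<Sum>y\<in>Y. \<Sum>z\<in>Z. P \<epsilon> x y z a * Q \<epsilon> x y z b * R \<epsilon> x y z c * inverse (e ^ 3))
        = (\<Sum>y\<in>Y. basis_vec y b' * e\<^sup>2 * inverse (e ^ 3) * (\<Sum>x\<in>X. \<Sum>z\<in>Z. u x y z a' * s x y z c'))"
        unfolding sum_distrib_left
        by (subst sum.swap) (simp add: P_def Q_def R_def e_def power2_eq_square mult_ac)
      then show ?thesis
        unfolding F_eq by (simp add: us tensor_dsum_def tensor_inl_def tensor_inr_def)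
    next
      fix a' b' c' assume [simp]: "a = Inl a'" "b = Inr b'" "c = Inr c'"
      have "(\<Sum>x\<in>X. \<Sum>y\<in>Y. \<Sum>z\<in>Z. P \<epsilon> x y z a * Q \<epsilon> x y z b * R \<epsilon> x y z c * inverse (e ^ 3))
        = (\<Sum>x\<in>X. basis_vec x a' * e\<^sup>2 * inverse (e ^ 3) * (\<Sum>y\<in>Y. \<Sum>z\<in>Z. v x y z b' * s x y z c'))"
        unfolding sum_distrib_left
        by (simp add: P_def Q_def R_def e_def power2_eq_square mult_ac)
      then show ?thesis
        unfolding F_eq by (simp add: vs tensor_dsum_def tensor_inl_def tensor_inr_def)
    next
      fix a' b' c' assume [simp]: "a = Inr a'" "b = Inr b'" "c = Inr c'"
      have "e * p * (e * q) * (e * r) * inverse (e ^ 3) = p * q * r" for p q r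
        using e by (simp add: field_simps power3_eq_cube)
      note scale = this
      show ?thesis
        unfolding F_eq
        by (simp add: scale P_def Q_def R_def tensor_dsum_def tensor_inl_def tensor_inr_def
            sum_fun_apply tprod_def basis_vec_def flip: e_def)
    qed
  qed
  have lim: "((\<lambda>\<epsilon>. F \<epsilon> (a, b, c, d)) \<longlongrightarrow> (?T \<oplus>\<^sub>T ?S) (a, b, c, d)) (at 0)" for a b c d
  proof (cases d)
    case (Inr d')
    have "\<forall>\<^sub>F \<epsilon> in at (0::real). F \<epsilon> (a, b, c, d) = (?T \<oplus>\<^sub>T ?S) (a, b, c, d)"
      unfolding eventually_at_filter by (simp add: Inr cancel)
    then show ?thesis by (rule tendsto_eventually)
  next
    case (Inl d')
    define Lx where "Lx x = case_sum (basis_vec x) (\<lambda>_::'j. 0)" for x :: 'a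
    define Ly where "Ly y = case_sum (basis_vec y) (\<lambda>_::'k. 0)" for y :: 'b
    define Lz where "Lz z = case_sum (basis_vec z) (\<lambda>_::'l. 0)" for z :: 'c
    have vanish: "((\<lambda>\<epsilon>. of_real \<epsilon> * g) \<longlongrightarrow> 0) (at (0::real))" for g :: complex
      by (rule tendsto_eq_intros refl | simp)+
    have "((\<lambda>\<epsilon>. P \<epsilon> x y z a) \<longlongrightarrow> Lx x a) (at 0)" "((\<lambda>\<epsilon>. Q \<epsilon> x y z b) \<longlongrightarrow> Ly y b) (at 0)"
         "((\<lambda>\<epsilon>. R \<epsilon> x y z c) \<longlongrightarrow> Lz z c) (at 0)" for x y z
      by (auto simp: P_def Q_def R_def Lx_def Ly_def Lz_def vanish split: sum.splits)
    then have "((\<lambda>\<epsilon>. \<Sum>x\<in>X. \<Sum>y\<in>Y. \<Sum>z\<in>Z. P \<epsilon> x y z a * Q \<epsilon> x y z b * R \<epsilon> x y z c * basis_vec (x, y, z) d')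
       \<longlongrightarrow> (\<Sum>x\<in>X. \<Sum>y\<in>Y. \<Sum>z\<in>Z. Lx x a * Ly y b * Lz z c * basis_vec (x, y, z) d')) (at 0)"
      by (intro tendsto_intros)
    also have "(\<lambda>\<epsilon>. \<Sum>x\<in>X. \<Sum>y\<in>Y. \<Sum>z\<in>Z. P \<epsilon> x y z a * Q \<epsilon> x y z b * R \<epsilon> x y z c * basis_vec (x, y, z) d')
       = (\<lambda>\<epsilon>. F \<epsilon> (a, b, c, d))"
      by (simp add: F_def sum_fun_apply tprod_def W_def Inl)
    also have "(\<Sum>x\<in>X. \<Sum>y\<in>Y. \<Sum>z\<in>Z. Lx x a * Ly y b * Lz z c * basis_vec (x, y, z) d') = (?T \<oplus>\<^sub>T ?S) (a, b, c, d)"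
      by (cases a; cases b; cases c)
         (simp_all add: Inl Lx_def Ly_def Lz_def tensor_dsum_def tensor_inl_def tensor_inr_def sum_fun_apply tprod_def)
    finally show ?thesis .
  qed
  show ?thesis
    using rank lim by (intro exI[of _ F]) (auto simp: tendsto_fun_iff)
qed

section \<open>The flattenings and the grid tensor\<close>

lemma flattening_minor_fst: "flattening_minor I (\<lambda>i j. (i, b j, c j, d j))"
  unfolding flattening_minor_def
proof (intro allI)
  fix u v w z
  show "\<exists>p q. \<forall>i\<in>I. \<forall>j\<in>I. tprod u v w z (i, b j, c j, d j) = p i * q j"
    by (rule exI[of _ u], rule exI[of _ "\<lambda>j. v (b j) * w (c j) * z (d j)"])
       (simp add: tprod_def mult.assoc)
qed

lemma flattening_minor_last: "flattening_minor I (\<lambda>i j. (a j, b j, c j, i))"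
  unfolding flattening_minor_def
proof (intro allI)
  fix u v w z
  show "\<exists>p q. \<forall>i\<in>I. \<forall>j\<in>I. tprod u v w z (a j, b j, c j, i) = p i * q j"
    by (rule exI[of _ z], rule exI[of _ "\<lambda>j. u (a j) * v (b j) * w (c j)"])
       (simp add: tprod_def mult_ac)
qed

lemma sum_delta3:
  fixes r :: "'r::comm_monoid_add"
  assumes "finite X" "finite Y" "finite Z"
  shows "(\<Sum>x\<in>X. \<Sum>y\<in>Y. \<Sum>z\<in>Z. if x = a \<and> y = b \<and> z = c then r else 0)
    = (if a \<in> X \<and> b \<in> Y \<and> c \<in> Z then r else 0)"
proof -
  have "(\<Sum>z\<in>Z. if x = a \<and> y = b \<and> z = c then r else 0)
      = (if x = a \<and> y = b \<and> c \<in> Z then r else 0)" for x y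
    using assms(3) by (cases "x = a \<and> y = b") auto
  moreover have "(\<Sum>y\<in>Y. if x = a \<and> y = b \<and> c \<in> Z then r else 0)
      = (if x = a \<and> b \<in> Y \<and> c \<in> Z then r else 0)" for x
    using assms(2) by (cases "x = a \<and> c \<in> Z") auto
  moreover have "(\<Sum>x\<in>X. if x = a \<and> b \<in> Y \<and> c \<in> Z then r else 0)
      = (if a \<in> X \<and> b \<in> Y \<and> c \<in> Z then r else 0)"
    using assms(1) by (cases "b \<in> Y \<and> c \<in> Z") auto
  ultimately show ?thesis by simp
qed

lemma grid_tensor_apply:
  assumes "finite X" "finite Y" "finite Z"
  shows "(\<Sum>x\<in>X. \<Sum>y\<in>Y. \<Sum>z\<in>Z. tprod (basis_vec x) (basis_vec y) (basis_vec z) (basis_vec (x, y, z)))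
    (a, b, c, t) = (if t = (a, b, c) \<and> t \<in> X \<times> Y \<times> Z then 1 else 0)"
proof -
  have "(\<Sum>x\<in>X. \<Sum>y\<in>Y. \<Sum>z\<in>Z. tprod (basis_vec x) (basis_vec y) (basis_vec z) (basis_vec (x, y, z)))
      (a, b, c, t) = (\<Sum>x\<in>X. \<Sum>y\<in>Y. \<Sum>z\<in>Z. if x = a \<and> y = b \<and> z = c then if t = (a, b, c) then 1 else 0 else 0)"
    unfolding sum_fun_apply by (intro sum.cong refl) (auto simp: tprod_def basis_vec_def)
  then show ?thesis
    by (auto simp: sum_delta3[OF assms])
qed

section \<open>A cancelling perturbation\<close>

lemma sum_by_parity: "(\<Sum>x = 0..2 * h + 1. f x) = (\<Sum>p = 0..h. f (2 * p) + f (2 * p + 1))"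
  for f :: "nat \<Rightarrow> 'a::comm_monoid_add"
  by (induction h) (simp_all add: add.assoc numeral_2_eq_2)

text \<open>
  Partners in the first coordinate are \<open>2 p\<close> and \<open>2 p + 1\<close>, so \<open>x div 2\<close> names the pair and the sign
  is the parity of x. Each j is attached to the cell \<open>(P j, Q j, R j)\<close> of pairs and grid points. The
  component j of u is 1 at this cell and is balanced by -1 on the last pair \<open>p = h\<close>. The component j
  of v is balanced on the last row \<open>y = n2\<close> instead. The bounds keep the cells away from \<open>p = h\<close> and
  \<open>y = n2\<close>, so the supports of component j of u and component k of v meet only where the cells of j and k
  coincide, which means \<open>j = k\<close> by injectivity. The bound on R keeps the cells away from \<open>z = n3\<close>, where s is balanced.
\<close>

lemma schonhage_vectors_exist:
  fixes P Q R :: "'j \<Rightarrow> nat"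
  assumes n1: "n1 = 2 * h + 1"
    and bound: "\<And>j. j \<in> J \<Longrightarrow> P j < h \<and> Q j < n2 \<and> R j < n3"
    and inj: "inj_on (\<lambda>j. (P j, Q j, R j)) J"
  shows "\<exists>u v (s :: nat \<Rightarrow> nat \<Rightarrow> nat \<Rightarrow> unit \<Rightarrow> complex).
    (\<forall>x y z. u x y z \<in> coord_space J) \<and> (\<forall>x y z. v x y z \<in> coord_space J) \<and>
    cancelling_perturbation {0..n1} {0..n2} {0..n3} u v s \<and>
    (\<forall>j k l. (\<Sum>x = 0..n1. \<Sum>y = 0..n2. \<Sum>z = 0..n3. u x y z j * v x y z k * s x y z l)
       = (if j = k \<and> j \<in> J then 1 else 0))"
proof -
  define f :: "'j \<Rightarrow> nat \<Rightarrow> nat \<Rightarrow> nat \<Rightarrow> complex" where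
    "f j p y z = (if j \<in> J \<and> y = Q j \<and> z = R j then (if p = P j then 1 else 0) - (if p = h then 1 else 0) else 0)"
    for j p y z
  \<comment> \<open>The factor 1/2 compensates for the two partners, which contribute equally to the sum of uvs.\<close>
  define g :: "'j \<Rightarrow> nat \<Rightarrow> nat \<Rightarrow> nat \<Rightarrow> complex" where
    "g k p y z = (if k \<in> J \<and> p = P k \<and> z = R k then ((if y = Q k then 1 else 0) - (if y = n2 then 1 else 0)) / 2 else 0)"
    for k p y z
  \<comment> \<open>Equal to 1 on all cells in use, with the last value chosen to make the total 0.\<close>
  define \<tau> :: "nat \<Rightarrow> complex" where "\<tau> z = 1 - (if z = n3 then of_nat (n3 + 1) else 0)" for z
  define u where "u x y z j = f j (x div 2) y z" for x y z j
  define v where "v x y z k = (- 1) ^ x * g k (x div 2) y z" for x y z k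
  define s :: "nat \<Rightarrow> nat \<Rightarrow> nat \<Rightarrow> unit \<Rightarrow> complex" where "s x y z l = (- 1) ^ x * \<tau> z" for x y z l
  have f: "(\<Sum>p = 0..h. f j p y z) = 0" for j y z
  proof (cases "j \<in> J \<and> y = Q j \<and> z = R j")
    case True
    then show ?thesis
      using bound[of j] by (simp add: f_def sum_subtractf)
  qed (auto simp: f_def)
  have g: "(\<Sum>y = 0..n2. g k p y z) = 0" for k p z
  proof (cases "k \<in> J \<and> p = P k \<and> z = R k")
    case True
    then have "(\<Sum>y = 0..n2. g k p y z)
      = (\<Sum>y = 0..n2. (if y = Q k then 1 else 0) - (if y = n2 then 1 else 0)) / 2"
      unfolding sum_divide_distrib by (intro sum.cong) (simp_all add: g_def)
    then show ?thesis
      using bound[of k] True by (simp add: sum_subtractf)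
  qed (auto simp: g_def)
  have \<tau>: "(\<Sum>z = 0..n3. \<tau> z) = 0"
    by (simp add: \<tau>_def sum_subtractf)
  have C0: "u x y z \<in> coord_space J" "v x y z \<in> coord_space J" for x y z
    by (auto simp: coord_space_def u_def v_def f_def g_def)
  have C1: "(\<Sum>x = 0..n1. u x y z j) = 0" for y z j
    unfolding n1 sum_by_parity sum.distrib by (simp add: u_def f)
  have C2: "(\<Sum>y = 0..n2. v x y z k) = 0" for x z k
    unfolding v_def sum_distrib_left[symmetric] g by simp
  have C3: "(\<Sum>z = 0..n3. s x y z l) = 0" for x y l
    unfolding s_def sum_distrib_left[symmetric] \<tau> by simp
  have C4: "(\<Sum>x = 0..n1. \<Sum>y = 0..n2. u x y z j * v x y z k) = 0" for z j k
    unfolding n1 sum_by_parity by (intro sum.neutral) (simp add: u_def v_def sum_negf)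
  have C5: "(\<Sum>x = 0..n1. \<Sum>z = 0..n3. u x y z j * s x y z l) = 0" for y j l
    unfolding n1 sum_by_parity by (intro sum.neutral) (simp add: u_def s_def sum_negf)
  have C6: "(\<Sum>y = 0..n2. \<Sum>z = 0..n3. v x y z k * s x y z l) = 0" for x k l
  proof -
    have "(\<Sum>y = 0..n2. \<Sum>z = 0..n3. v x y z k * s x y z l)
       = (\<Sum>z = 0..n3. (\<Sum>y = 0..n2. v x y z k) * ((- 1) ^ x * \<tau> z))"
      by (subst sum.swap) (simp add: s_def sum_distrib_right)
    then show ?thesis by (simp add: C2)
  qed
  have C7: "(\<Sum>x = 0..n1. \<Sum>y = 0..n2. \<Sum>z = 0..n3. u x y z j * v x y z k * s x y z l)
       = (if j = k \<and> j \<in> J then 1 else 0)" for j k l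
  proof -
    have point: "2 * (f j p y z * g k p y z * \<tau> z) =
      (if p = P j \<and> y = Q j \<and> z = R j then if j = k \<and> j \<in> J then 1 else 0 else 0)" for p y z
    proof (cases "j \<in> J \<and> k \<in> J \<and> p = P k \<and> y = Q j \<and> z = R j \<and> R j = R k")
      case True
      have "P j < h" "P k < h" "Q j < n2" "R j < n3"
        using bound True by blast+
      moreover have "j = k" if "P k = P j" "Q j = Q k"
        using inj_onD[OF inj, of j k] that True by simp
      ultimately show ?thesis
        using True by (auto simp: f_def g_def \<tau>_def)
    next
      case False
      have "j \<in> J \<and> y = Q j \<and> z = R j" if "f j p y z \<noteq> 0"
        using that unfolding f_def by meson
      moreover have "k \<in> J \<and> p = P k \<and> z = R k" if "g k p y z \<noteq> 0"
        using that unfolding g_def by meson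
      ultimately have "f j p y z = 0 \<or> g k p y z = 0"
        using False by metis
      moreover have "\<not> (p = P j \<and> y = Q j \<and> z = R j \<and> j = k \<and> j \<in> J)"
        using False by metis
      ultimately show ?thesis by auto
    qed
    have "(\<Sum>x = 0..n1. \<Sum>y = 0..n2. \<Sum>z = 0..n3. u x y z j * v x y z k * s x y z l)
      = (\<Sum>p = 0..h. \<Sum>y = 0..n2. \<Sum>z = 0..n3. 2 * (f j p y z * g k p y z * \<tau> z))"
      unfolding n1 sum_by_parity
      by (intro sum.cong refl) (simp add: u_def v_def s_def sum_distrib_left mult.assoc)
    also have "\<dots> = (if j = k \<and> j \<in> J then 1 else 0)"
      unfolding point using bound[of j] by (auto simp: sum_delta3)
    finally show ?thesis .
  qed
  show ?thesis
    unfolding cancelling_perturbation_def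
    by (rule exI[of _ u], rule exI[of _ v], rule exI[of _ s])
       (simp only: C0 C1 C2 C3 C4 C5 C6 C7 simp_thms)
qed

section \<open>The border ranks\<close>

theorem theorem3p1:
  fixes n1 n2 n3 N :: nat
    and T1 :: "(nat, nat, nat, nat \<times> nat \<times> nat) tensor"
    and T2 :: "(nat, nat, unit, unit) tensor"
  assumes "n1 \<ge> 2" and "n2 \<ge> 2" and "n3 \<ge> 2" and "odd n1"
    and "N = (n1 - 1) * (n2 - 1) * (n3 - 1) div 2"
    and "T1 = (\<Sum>i1 = 0..n1. \<Sum>i2 = 0..n2. \<Sum>i3 = 0..n3.
           tprod (basis_vec i1) (basis_vec i2) (basis_vec i3) (basis_vec (i1, i2, i3)))"
    and "T2 = (\<Sum>j = 1..N.
           tprod (basis_vec j) (basis_vec j) (basis_vec ()) (basis_vec ()))"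
  shows "border_rank {0..n1} {0..n2} {0..n3} ({0..n1} \<times> {0..n2} \<times> {0..n3}) T1
           = (n1 + 1) * (n2 + 1) * (n3 + 1)
       \<and> border_rank {1..N} {1..N} {()} {()} T2 = N
       \<and> border_rank ({0..n1} <+> {1..N}) ({0..n2} <+> {1..N}) ({0..n3} <+> {()})
             (({0..n1} \<times> {0..n2} \<times> {0..n3}) <+> {()}) (T1 \<oplus>\<^sub>T T2)
           = (n1 + 1) * (n2 + 1) * (n3 + 1) + 1"
proof (intro conjI)
  let ?grid = "{0..n1} \<times> {0..n2} \<times> {0..n3}"
  have card_grid: "card ?grid = (n1 + 1) * (n2 + 1) * (n3 + 1)"
    by (simp only: card_cartesian_product card_atLeastAtMost minus_nat.diff_0 Suc_eq_plus1 mult.assoc)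
  have basis: "basis_vec i \<in> coord_space A" if "i \<in> A" for i :: 'x and A
    using that by (auto simp: basis_vec_def coord_space_def)
  have T1: "T1 (a, b, c, t) = (if t = (a, b, c) \<and> t \<in> ?grid then 1 else 0)" for a b c t
    unfolding assms(6) by (rule grid_tensor_apply) simp_all
  have T2: "T2 (j, k, l, m) = (if j = k \<and> j \<in> {1..N} then 1 else 0)" for j k l m
  proof -
    have "T2 (j, k, l, m) = (\<Sum>i = 1..N. if i = j then if j = k then 1 else 0 else 0)"
      unfolding assms(7) sum_fun_apply
      by (intro sum.cong) (auto simp: tprod_def basis_vec_def)
    then show ?thesis by auto
  qed

  show "border_rank {0..n1} {0..n2} {0..n3} ?grid T1 = (n1 + 1) * (n2 + 1) * (n3 + 1)"
    unfolding card_grid[symmetric]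
  proof (rule border_rank_eqI[where F = "\<lambda>_. T1"])
    show "flattening_minor ?grid (\<lambda>i j. (fst j, fst (snd j), snd (snd j), i))"
      by (rule flattening_minor_last)
    have "simple_sum {0..n1} {0..n2} {0..n3} ?grid
        (card {0..n1} * (card {0..n2} * (card {0..n3} * 1))) T1"
      unfolding assms(6) by (intro simple_sum_sum simple_sum_tprod basis) auto
    then show "simple_sum {0..n1} {0..n2} {0..n3} ?grid (card ?grid) T1"
      by (simp only: card_cartesian_product mult_1_right)
  qed (auto simp: T1)

  have "border_rank {1..N} {1..N} {()} {()} T2 = card {1..N}"
  proof (rule border_rank_eqI[where F = "\<lambda>_. T2"])
    show "flattening_minor {1..N} (\<lambda>i j. (i, j, (), ()))"
      by (rule flattening_minor_fst)
    have "simple_sum {1..N} {1..N} {()} {()} (card {1..N} * 1) T2"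
      unfolding assms(7) by (intro simple_sum_sum simple_sum_tprod basis) auto
    then show "simple_sum {1..N} {1..N} {()} {()} (card {1..N}) T2"
      by simp
  qed (auto simp: T2)
  then show "border_rank {1..N} {1..N} {()} {()} T2 = N"
    by simp

  obtain h where h: "n1 = 2 * h + 1"
    using assms(4) by (auto elim: oddE)
  have N: "N = h * (n2 - 1) * (n3 - 1)"
    unfolding assms(5) h by simp
  have "N \<ge> 1"
    unfolding N using assms(1-3) h by (simp add: Suc_le_eq)
  \<comment> \<open>The cells carrying the N components; N is their number because \<open>n1 - 1 = 2 h\<close>.\<close>
  have "card {1..N} = card ({..<h} \<times> {..<n2 - 1} \<times> {..<n3 - 1})"
    by (simp add: card_cartesian_product N)
  then obtain \<phi> where \<phi>: "bij_betw \<phi> {1..N} ({..<h} \<times> {..<n2 - 1} \<times> {..<n3 - 1})"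
    using finite_same_card_bij[of "{1..N}" "{..<h} \<times> {..<n2 - 1} \<times> {..<n3 - 1}"] by auto
  have inj: "inj_on (\<lambda>j. (fst (\<phi> j), fst (snd (\<phi> j)), snd (snd (\<phi> j)))) {1..N}"
    using bij_betw_imp_inj_on[OF \<phi>] by simp
  have bound: "fst (\<phi> j) < h \<and> fst (snd (\<phi> j)) < n2 \<and> snd (snd (\<phi> j)) < n3" if "j \<in> {1..N}" for j
    using bij_betwE[OF \<phi>] that by fastforce
  obtain u v and s :: "nat \<Rightarrow> nat \<Rightarrow> nat \<Rightarrow> unit \<Rightarrow> complex" where uvs:
    "\<And>x y z. u x y z \<in> coord_space {1..N}" "\<And>x y z. v x y z \<in> coord_space {1..N}"
    "cancelling_perturbation {0..n1} {0..n2} {0..n3} u v s"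
    and S: "\<And>j k l. (\<Sum>x = 0..n1. \<Sum>y = 0..n2. \<Sum>z = 0..n3. u x y z j * v x y z k * s x y z l)
       = (if j = k \<and> j \<in> {1..N} then 1 else 0)"
    using schonhage_vectors_exist[OF h bound inj] by auto
  have s_supp: "s x y z \<in> coord_space {()}" for x y z :: nat
    by (simp add: coord_space_def)
  have T2_eq: "(\<Sum>x = 0..n1. \<Sum>y = 0..n2. \<Sum>z = 0..n3. tprod (u x y z) (v x y z) (s x y z) (basis_vec ())) = T2"
  proof
    fix t :: "nat \<times> nat \<times> unit \<times> unit"
    obtain j k l m where "t = (j, k, l, m)" by (rule prod_cases4)
    then have t: "t = (j, k, (), ())" by simp
    show "(\<Sum>x = 0..n1. \<Sum>y = 0..n2. \<Sum>z = 0..n3. tprod (u x y z) (v x y z) (s x y z) (basis_vec ())) t = T2 t"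
      unfolding t T2 S[of j k "()", symmetric] by (simp add: sum_fun_apply tprod_def basis_vec_def)
  qed
  obtain F where F: "\<And>\<epsilon>::real. \<epsilon> \<noteq> 0 \<Longrightarrow> simple_sum ({0..n1} <+> {1..N}) ({0..n2} <+> {1..N}) ({0..n3} <+> {()})
       (?grid <+> {()}) (card ?grid + 1) (F \<epsilon>)"
    and lim: "(F \<longlongrightarrow> T1 \<oplus>\<^sub>T T2) (at 0)"
    using schonhage_degeneration[OF _ _ _ uvs(1,2) s_supp uvs(3)]
    unfolding T2_eq assms(6)[symmetric] by auto
  have card: "card (?grid <+> {()}) = card ?grid + 1"
    by (simp add: card_Plus)
  \<comment> \<open>The first three indices of each column. For the row of the added line any diagonal position
     of \<open>T2\<close> would do, and 1 is one because N is positive.\<close>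
  define col :: "nat \<times> nat \<times> nat + unit \<Rightarrow> (nat + nat) \<times> (nat + nat) \<times> (nat + unit)"
    where "col = case_sum (\<lambda>(x, y, z). (Inl x, Inl y, Inl z)) (\<lambda>_::unit. (Inr 1, Inr 1, Inr ()))"
  have "border_rank ({0..n1} <+> {1..N}) ({0..n2} <+> {1..N}) ({0..n3} <+> {()}) (?grid <+> {()}) (T1 \<oplus>\<^sub>T T2)
     = card (?grid <+> {()})"
  proof (rule border_rank_eqI[OF _ _ _ _ _ _ _ lim])
    show "flattening_minor (?grid <+> {()}) (\<lambda>i j. (fst (col j), fst (snd (col j)), snd (snd (col j)), i))"
      by (rule flattening_minor_last)
    show "(T1 \<oplus>\<^sub>T T2) (fst (col j), fst (snd (col j)), snd (snd (col j)), i) = (if i = j then 1 else 0)"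
      if "i \<in> ?grid <+> {()}" "j \<in> ?grid <+> {()}" for i j
      using that \<open>N \<ge> 1\<close>
      by (auto simp: col_def tensor_dsum_def tensor_inl_def tensor_inr_def T1 T2 split: if_splits)
  qed (use F card in auto)
  then show "border_rank ({0..n1} <+> {1..N}) ({0..n2} <+> {1..N}) ({0..n3} <+> {()}) (?grid <+> {()}) (T1 \<oplus>\<^sub>T T2)
     = (n1 + 1) * (n2 + 1) * (n3 + 1) + 1"
    unfolding card card_grid .
qed

end
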